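(* Let $\mathcal L:\Theta\to\mathbb R$ be differentiable at $\theta\in\Theta$, let $\eta>0$, and let $M=\mathrm{diag}(m_1,\dots,m_P)$ with $m_i\in\{0,1\}$ for every $i$. Let $\theta'=\theta-\eta\,M\,\nabla_\theta\mathcal L(\theta)$ and let $K\subset\Theta$ be a compact set containing the line segment $\{\theta+t(\theta'-\theta):t\in[0,1]\}$. Then, for every layer $\ell$ and every input $x\in\mathbb R^d$, $$\|R_\ell(\theta';x)-R_\ell(\theta;x)\|\;\le\;\eta\,L_\ell(K)\,\|M\nabla_\theta\mathcal L(\theta)\|\;\le\;\eta\,L_\ell(K)\,\|\nabla_\theta\mathcal L(\theta)\|,$$ where $L_\ell(K)=\sup_{\vartheta\in K}\|\nabla_\theta R_\ell(\vartheta;x)\|_{\mathrm{op}}$.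
   Context: $\Theta\subset\mathbb R^P$ is the open parameter set of a decoder-only transformer. $\|\cdot\|$ is the Euclidean norm, $\|\cdot\|_{\mathrm{op}}$ the induced operator norm, and $\nabla_\theta R_\ell(\theta;x)$ is the Jacobian of $\theta\mapsto R_\ell(\theta;x)$. The residual maps $R_\ell$: the hidden state is regarded as a vector in $\mathbb R^d$. For $x\in\mathbb R^d$ and $\theta\in\Theta$ put $R_0(\theta;x)=x$ and $R_\ell(\theta;x)=G_{\ell,\theta}(R_{\ell-1}(\theta;x))$, where $G_{\ell,\theta}:\mathbb R^d\to\mathbb R^d$ is the $\ell$-th block. A block is a residual map $u\mapsto u+F(\mathrm{RMSNorm}(u))$ (or a finite composition of such maps), where $F$ is built by finitely many compositions, sums and products from the following primitives, whose parameters (entries of $W$ and of $\gamma$) are coordinates of $\theta$: linear projections $u\mapsto Wu$; rotary position embeddings $u\mapsto Ru$ with $R$ a fixed rotation matrix; softmax $\sigma(z)_i=e^{z_i}/\sum_j e^{z_j}$; SwiGLU $(u,v)\mapsto \mathrm{SiLU}(u)\odot v$, where $\mathrm{SiLU}(t)=t/(1+e^{-t})$ acts entrywise and $\odot$ is the entrywise product; and $\mathrm{RMSNorm}(u)=\gamma\odot u/\sqrt{\tfrac1d\|u\|^2+\varepsilon}$ with a fixed $\varepsilon>0$. *)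

theory Defs
  imports
    "HOL-Analysis.Analysis"
    "Jordan_Normal_Form.Determinant"
begin

text \<open>
  The parameter space and the hidden state space are \<open>real ^ 'p\<close> and \<open>real ^ 'd\<close>. Inside a block
  the dimensions vary (heads, feed-forward width), so intermediate vectors live in
  \<open>real Matrix.vec\<close>, whose dimension is a term. The symbol \<open>$\<close> is kept for \<open>real ^ 'n\<close>.
\<close>

no_notation Matrix.vec_index (infixl "$" 100)
notation Matrix.vec_index (infixl "$v" 100)


subsection \<open>Primitives\<close>

definition param_vec :: "nat \<Rightarrow> (nat \<Rightarrow> 'p) \<Rightarrow> real ^ 'p \<Rightarrow> real Matrix.vec" where
  "param_vec n c \<theta> = Matrix.vec n (\<lambda>i. \<theta> $ c i)"

definition param_mat :: "nat \<Rightarrow> nat \<Rightarrow> (nat \<Rightarrow> nat \<Rightarrow> 'p) \<Rightarrow> real ^ 'p \<Rightarrow> real Matrix.mat" where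
  "param_mat m n w \<theta> = Matrix.mat m n (\<lambda>(i, j). \<theta> $ w i j)"

definition rotation_mat :: "nat \<Rightarrow> real Matrix.mat \<Rightarrow> bool" where
  "rotation_mat n Q \<longleftrightarrow>
     Q \<in> carrier_mat n n \<and> transpose_mat Q * Q = 1\<^sub>m n \<and> Determinant.det Q = 1"

definition softmax :: "real Matrix.vec \<Rightarrow> real Matrix.vec" where
  "softmax z = Matrix.vec (dim_vec z) (\<lambda>i. exp (z $v i) / (\<Sum>j<dim_vec z. exp (z $v j)))"

definition silu :: "real \<Rightarrow> real" where
  "silu t = t / (1 + exp (- t))"

definition hadamard :: "real Matrix.vec \<Rightarrow> real Matrix.vec \<Rightarrow> real Matrix.vec" where
  "hadamard u v = Matrix.vec (dim_vec u) (\<lambda>i. u $v i * v $v i)"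

definition swiglu :: "real Matrix.vec \<Rightarrow> real Matrix.vec \<Rightarrow> real Matrix.vec" where
  "swiglu u v = hadamard (map_vec silu u) v"

definition rmsnorm :: "real \<Rightarrow> real Matrix.vec \<Rightarrow> real Matrix.vec \<Rightarrow> real Matrix.vec" where
  "rmsnorm \<epsilon> \<gamma> u =
     (1 / sqrt (1 / real (dim_vec u) * (\<Sum>j<dim_vec u. (u $v j)\<^sup>2) + \<epsilon>)) \<cdot>\<^sub>v hadamard \<gamma> u"

text \<open>
  Product of an \<open>a \<times> b\<close> by a \<open>b \<times> c\<close> matrix, all three stored row by row as vectors.
\<close>

definition flat_matmul ::
    "nat \<Rightarrow> nat \<Rightarrow> nat \<Rightarrow> real Matrix.vec \<Rightarrow> real Matrix.vec \<Rightarrow> real Matrix.vec" where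
  "flat_matmul a b c u v =
     Matrix.vec (a * c) (\<lambda>k. \<Sum>j<b. u $v (k div c * b + j) * v $v (j * c + k mod c))"


subsection \<open>Maps built from the primitives\<close>

text \<open>
  \<open>built \<epsilon> n m f\<close>: the parametrised map \<open>f \<theta> : \<real>\<^sup>n \<rightarrow> \<real>\<^sup>m\<close> is built by finitely many compositions,
  sums and products from the primitives; \<open>f\<close> is meaningful on vectors of dimension \<open>n\<close> only.
  Products are entrywise (\<open>prod\<close>) or products of flattened matrices (\<open>matmul\<close>, as in attention).
  The rules \<open>select\<close> and \<open>concat\<close> only move coordinates around; they express the splitting into and
  the joining of tokens and heads, transposition, and causal truncation of a row of scores.
  The assignments \<open>w\<close> and \<open>c\<close> of coordinates of \<open>\<theta>\<close> to weights need not be injective, so a weight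
  may be used several times, for instance once for every token.
\<close>

inductive built ::
    "real \<Rightarrow> nat \<Rightarrow> nat \<Rightarrow> (real ^ 'p \<Rightarrow> real Matrix.vec \<Rightarrow> real Matrix.vec) \<Rightarrow> bool"
  for \<epsilon> :: real where
  linear: "built \<epsilon> n m (\<lambda>\<theta> u. param_mat m n w \<theta> *\<^sub>v u)"
| rope: "rotation_mat n Q \<Longrightarrow> built \<epsilon> n n (\<lambda>\<theta> u. Q *\<^sub>v u)"
| softmax: "built \<epsilon> n n (\<lambda>\<theta> u. softmax u)"
| swiglu: "built \<epsilon> n m f \<Longrightarrow> built \<epsilon> n m g \<Longrightarrow> built \<epsilon> n m (\<lambda>\<theta> u. swiglu (f \<theta> u) (g \<theta> u))"
| rmsnorm: "built \<epsilon> n n (\<lambda>\<theta> u. rmsnorm \<epsilon> (param_vec n c \<theta>) u)"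
| comp: "built \<epsilon> n m f \<Longrightarrow> built \<epsilon> m k g \<Longrightarrow> built \<epsilon> n k (\<lambda>\<theta> u. g \<theta> (f \<theta> u))"
| sum: "built \<epsilon> n m f \<Longrightarrow> built \<epsilon> n m g \<Longrightarrow> built \<epsilon> n m (\<lambda>\<theta> u. f \<theta> u + g \<theta> u)"
| prod: "built \<epsilon> n m f \<Longrightarrow> built \<epsilon> n m g \<Longrightarrow> built \<epsilon> n m (\<lambda>\<theta> u. hadamard (f \<theta> u) (g \<theta> u))"
| matmul: "built \<epsilon> n (a * b) f \<Longrightarrow> built \<epsilon> n (b * c) g \<Longrightarrow>
    built \<epsilon> n (a * c) (\<lambda>\<theta> u. flat_matmul a b c (f \<theta> u) (g \<theta> u))"
| select: "(\<And>i. i < m \<Longrightarrow> s i < n) \<Longrightarrow> built \<epsilon> n m (\<lambda>\<theta> u. Matrix.vec m (\<lambda>i. u $v s i))"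
| concat: "built \<epsilon> n m f \<Longrightarrow> built \<epsilon> n k g \<Longrightarrow> built \<epsilon> n (m + k) (\<lambda>\<theta> u. f \<theta> u @\<^sub>v g \<theta> u)"


subsection \<open>Blocks and residual maps\<close>

text \<open>
  The index type \<open>'d\<close> carries no order, so \<open>real ^ 'd\<close> is identified with the vectors of dimension
  \<open>CARD('d)\<close> along the library's enumeration of \<open>UNIV :: 'd set\<close>.
\<close>

definition to_dvec :: "real ^ 'd \<Rightarrow> real Matrix.vec" where
  "to_dvec x = Matrix.vec CARD('d) (\<lambda>i. x $ from_nat_into UNIV i)"

definition of_dvec :: "real Matrix.vec \<Rightarrow> real ^ 'd" where
  "of_dvec v = (\<chi> i. v $v to_nat_on UNIV i)"

inductive block :: "real \<Rightarrow> (real ^ 'p \<Rightarrow> real ^ 'd \<Rightarrow> real ^ 'd) \<Rightarrow> bool"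
  for \<epsilon> :: real where
  residual: "built \<epsilon> CARD('d) CARD('d) F \<Longrightarrow>
    block \<epsilon> (\<lambda>\<theta> (u :: real ^ 'd).
      u + of_dvec (F \<theta> (rmsnorm \<epsilon> (param_vec CARD('d) c \<theta>) (to_dvec u))))"
| comp: "block \<epsilon> G \<Longrightarrow> block \<epsilon> H \<Longrightarrow> block \<epsilon> (\<lambda>\<theta> u. H \<theta> (G \<theta> u))"

primrec residual_map ::
    "(nat \<Rightarrow> real ^ 'p \<Rightarrow> real ^ 'd \<Rightarrow> real ^ 'd) \<Rightarrow> nat \<Rightarrow> real ^ 'p \<Rightarrow> real ^ 'd \<Rightarrow> real ^ 'd" where
  "residual_map G 0 \<theta> x = x"
| "residual_map G (Suc l) \<theta> x = G (Suc l) \<theta> (residual_map G l \<theta> x)"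


subsection \<open>Gradient, mask and Lipschitz constant\<close>

definition gradient :: "(real ^ 'p \<Rightarrow> real) \<Rightarrow> real ^ 'p \<Rightarrow> real ^ 'p" where
  "gradient f \<theta> = (\<chi> i. frechet_derivative f (at \<theta>) (axis i 1))"

definition diag_matrix :: "real ^ 'p \<Rightarrow> real ^ 'p ^ 'p" where
  "diag_matrix m = (\<chi> i j. if i = j then m $ i else 0)"

text \<open>
  A supremum of reals: it is the genuine one only if the norms are bounded on \<open>K\<close>, which holds for
  compact \<open>K\<close> since residual maps are continuously differentiable in \<open>\<theta>\<close>.
\<close>

definition sup_jacobian_norm :: "(real ^ 'p \<Rightarrow> real ^ 'd) \<Rightarrow> (real ^ 'p) set \<Rightarrow> real" where
  "sup_jacobian_norm R K = (SUP \<theta>\<in>K. onorm (\<lambda>h. jacobian R (at \<theta>) *v h))"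

end

theory Submission
  imports Defs
begin

text \<open>
  All primitives are continuously differentiable: the denominators of softmax, SiLU and RMSNorm
  never vanish, the last because \<open>\<epsilon> > 0\<close>. Hence for fixed \<open>x\<close> the map \<open>\<theta> \<mapsto> R\<^sub>l(\<theta>; x)\<close> is
  continuously differentiable, its Jacobian is bounded on the compact set \<open>K\<close>, and the mean value
  inequality on the segment gives the first estimate. The second holds since a 0/1 mask does not
  increase the Euclidean norm.
\<close>

subsection \<open>Continuously differentiable functions\<close>

no_notation scalar_prod (infix "\<bullet>" 70)

text \<open>The derivative is stored as a gradient vector \<open>g x\<close>, so that its continuity
  is plain continuity of a function into the space itself. Regularity is required on the whole
  space, which suits maps whose denominators vanish nowhere.\<close>

definition C1 :: "('a :: real_inner \<Rightarrow> real) \<Rightarrow> bool" where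
  "C1 f \<longleftrightarrow> (\<exists>g. (\<forall>x. (f has_derivative (\<lambda>h. g x \<bullet> h)) (at x)) \<and> continuous_on UNIV g)"

lemma C1I:
  assumes "\<And>x. (f has_derivative (\<lambda>h. g x \<bullet> h)) (at x)" "continuous_on UNIV g"
  shows "C1 f"
  using assms unfolding C1_def by blast

text \<open>Continuity of \<open>f\<close> is delivered along with the gradient because the
  gradients in the product and chain rules contain \<open>f\<close> itself.\<close>

lemma C1E:
  assumes "C1 f"
  obtains g where "\<And>x. (f has_derivative (\<lambda>h. g x \<bullet> h)) (at x)" "continuous_on UNIV g"
    "continuous_on UNIV f"
proof -
  obtain g where g: "\<And>x. (f has_derivative (\<lambda>h. g x \<bullet> h)) (at x)" "continuous_on UNIV g"
    using assms unfolding C1_def by blast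
  then have "continuous_on UNIV f"
    by (meson continuous_at_imp_continuous_on has_derivative_continuous)
  with g show ?thesis by (rule that)
qed

lemma C1_const: "C1 (\<lambda>x. c)"
  by (rule C1I[where g = "\<lambda>x. 0"]) (auto intro!: derivative_eq_intros)

lemma C1_inner: "C1 (\<lambda>x. a \<bullet> x)"
  by (rule C1I[where g = "\<lambda>x. a"]) (auto intro!: derivative_eq_intros)

lemma C1_component: "C1 (\<lambda>x :: real ^ 'n. x $ i)"
  using C1_inner[of "axis i (1 :: real)"] by (simp add: inner_axis')

lemma C1_add:
  assumes "C1 f" "C1 g"
  shows "C1 (\<lambda>x. f x + g x)"
proof -
  obtain f' where f: "\<And>x. (f has_derivative (\<lambda>h. f' x \<bullet> h)) (at x)" "continuous_on UNIV f'"
    using C1E[OF assms(1)] by metis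
  obtain g' where g: "\<And>x. (g has_derivative (\<lambda>h. g' x \<bullet> h)) (at x)" "continuous_on UNIV g'"
    using C1E[OF assms(2)] by metis
  show ?thesis
    by (rule C1I[where g = "\<lambda>x. f' x + g' x"])
       (auto intro!: derivative_eq_intros f g continuous_intros simp: inner_add_left)
qed

lemma C1_mult:
  assumes "C1 f" "C1 g"
  shows "C1 (\<lambda>x. f x * g x)"
proof -
  obtain f' where f: "\<And>x. (f has_derivative (\<lambda>h. f' x \<bullet> h)) (at x)" "continuous_on UNIV f'"
      "continuous_on UNIV f"
    using C1E[OF assms(1)] by metis
  obtain g' where g: "\<And>x. (g has_derivative (\<lambda>h. g' x \<bullet> h)) (at x)" "continuous_on UNIV g'"
      "continuous_on UNIV g"
    using C1E[OF assms(2)] by metis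
  show ?thesis
    by (rule C1I[where g = "\<lambda>x. f x *\<^sub>R g' x + g x *\<^sub>R f' x"])
       (auto intro!: derivative_eq_intros f g continuous_intros simp: inner_add_left)
qed

lemma C1_sum:
  assumes "\<And>i. i \<in> A \<Longrightarrow> C1 (f i)"
  shows "C1 (\<lambda>x. \<Sum>i\<in>A. f i x)"
  \<comment> \<open>Over an infinite index set the sum is 0 by convention and falls under
    \<open>C1_const\<close>.\<close>
  using assms by (induction A rule: infinite_finite_induct) (auto intro: C1_const C1_add)

text \<open>Chain rule with an outer function that is regular only on a set \<open>S\<close>
  containing the range of \<open>f\<close>; this accommodates reciprocals and square roots.\<close>

lemma C1_compose:
  fixes \<phi> \<phi>' :: "real \<Rightarrow> real"
  assumes "C1 f" and "range f \<subseteq> S" and "continuous_on S \<phi>'"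
    and "\<And>t. t \<in> S \<Longrightarrow> (\<phi> has_real_derivative \<phi>' t) (at t)"
  shows "C1 (\<lambda>x. \<phi> (f x))"
proof -
  obtain f' where f: "\<And>x. (f has_derivative (\<lambda>h. f' x \<bullet> h)) (at x)" "continuous_on UNIV f'"
      "continuous_on UNIV f"
    using C1E[OF assms(1)] by metis
  have "((\<lambda>x. \<phi> (f x)) has_derivative (\<lambda>h. (\<phi>' (f x) *\<^sub>R f' x) \<bullet> h)) (at x)" for x
    using has_derivative_compose[OF f(1) assms(4)[unfolded has_field_derivative_def]] assms(2)
    by (auto simp: image_subset_iff)
  moreover have "continuous_on UNIV (\<lambda>x. \<phi>' (f x))"
    by (rule continuous_on_compose2[OF assms(3) f(3) assms(2)])
  ultimately show ?thesis
    by (intro C1I[where g = "\<lambda>x. \<phi>' (f x) *\<^sub>R f' x"]) (auto intro!: continuous_intros f)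
qed

lemma C1_exp: "C1 f \<Longrightarrow> C1 (\<lambda>x. exp (f x))"
  by (rule C1_compose[where S = UNIV and \<phi>' = exp]) (auto intro!: derivative_eq_intros continuous_intros)

lemma C1_inverse:
  assumes "C1 f" "\<And>x. f x \<noteq> 0"
  shows "C1 (\<lambda>x. inverse (f x))"
  by (rule C1_compose[where S = "- {0}" and \<phi>' = "\<lambda>t. - (inverse t)\<^sup>2"])
     (use assms in \<open>auto intro!: derivative_eq_intros continuous_intros simp: power2_eq_square\<close>)

lemma C1_divide:
  assumes "C1 f" "C1 g" "\<And>x. g x \<noteq> 0"
  shows "C1 (\<lambda>x. f x / g x)"
  unfolding divide_inverse by (intro C1_mult C1_inverse assms)

lemma C1_sqrt:
  assumes "C1 f" "\<And>x. f x > 0"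
  shows "C1 (\<lambda>x. sqrt (f x))"
  by (rule C1_compose[where S = "{0<..}" and \<phi>' = "\<lambda>t. inverse (sqrt t) / 2"])
     (use assms in \<open>auto intro!: DERIV_real_sqrt continuous_intros\<close>)

section \<open>Vector-valued maps: coordinatewise regularity and the Jacobian\<close>

definition C1_cart :: "('a :: real_inner \<Rightarrow> real ^ 'n) \<Rightarrow> bool" where
  "C1_cart f \<longleftrightarrow> (\<forall>i. C1 (\<lambda>x. f x $ i))"

text \<open>Vectors of all dimensions share one type, so regularity is stated by coordinates. The
  fixed dimension ensures that the coordinates below \<open>n\<close> describe the map
  completely.\<close>

definition C1_vec :: "nat \<Rightarrow> ('a :: real_inner \<Rightarrow> real Matrix.vec) \<Rightarrow> bool" where
  "C1_vec n f \<longleftrightarrow> (\<forall>x. dim_vec (f x) = n) \<and> (\<forall>i<n. C1 (\<lambda>x. f x $v i))"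

lemma C1_vecI:
  assumes "\<And>x. dim_vec (f x) = n" "\<And>i. i < n \<Longrightarrow> C1 (\<lambda>x. f x $v i)"
  shows "C1_vec n f"
  using assms by (simp add: C1_vec_def)

lemma C1_vec_dim: "C1_vec n f \<Longrightarrow> dim_vec (f x) = n"
  by (simp add: C1_vec_def)

lemma C1_vec_index: "C1_vec n f \<Longrightarrow> i < n \<Longrightarrow> C1 (\<lambda>x. f x $v i)"
  by (simp add: C1_vec_def)

text \<open>The rows of the Jacobian are the gradients of the coordinates. The sum of their norms
  dominates the operator norm and is continuous, hence bounded on compact \<open>K\<close>; so the
  supremum in \<open>sup_jacobian_norm\<close> is taken over a set bounded above.\<close>

lemma C1_cart_jacobian:
  fixes f :: "real ^ 'p \<Rightarrow> real ^ 'd"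
  assumes "C1_cart f" "compact K"
  shows "\<And>x. (f has_derivative (\<lambda>h. jacobian f (at x) *v h)) (at x)"
    and "bdd_above ((\<lambda>x. onorm (\<lambda>h. jacobian f (at x) *v h)) ` K)"
proof -
  have "\<forall>i. \<exists>g. (\<forall>x. ((\<lambda>x. f x $ i) has_derivative (\<lambda>h. g x \<bullet> h)) (at x)) \<and> continuous_on UNIV g"
    using assms(1) by (simp add: C1_cart_def C1_def)
  then obtain g where g: "\<And>i x. ((\<lambda>x. f x $ i) has_derivative (\<lambda>h. g i x \<bullet> h)) (at x)"
    "\<And>i. continuous_on UNIV (g i)"
    by metis
  have D: "(f has_derivative (\<lambda>h. \<chi> i. g i x \<bullet> h)) (at x)" for x
    by (subst has_derivative_componentwise_within) (auto simp: Basis_vec_def inner_axis g(1))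
  then show J: "(f has_derivative (\<lambda>h. jacobian f (at x) *v h)) (at x)" for x
    using jacobian_works differentiableI by blast
  \<comment> \<open>Uniqueness of the derivative ties the Jacobian to the gradients, whose
    continuity is known.\<close>
  have J_eq: "(\<lambda>h. jacobian f (at x) *v h) = (\<lambda>h. \<chi> i. g i x \<bullet> h)" for x
    by (rule has_derivative_unique[OF J D])
  have bound: "onorm (\<lambda>h. jacobian f (at x) *v h) \<le> (\<Sum>i\<in>UNIV. norm (g i x))" for x
  proof (rule onorm_le)
    fix h :: "real ^ 'p"
    have "norm (\<chi> i. g i x \<bullet> h) \<le> (\<Sum>i\<in>UNIV. \<bar>g i x \<bullet> h\<bar>)"
      using norm_le_l1_cart[of "\<chi> i. g i x \<bullet> h"] by simp
    also have "\<dots> \<le> (\<Sum>i\<in>UNIV. norm (g i x) * norm h)"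
      by (intro sum_mono Cauchy_Schwarz_ineq2)
    finally show "norm (jacobian f (at x) *v h) \<le> (\<Sum>i\<in>UNIV. norm (g i x)) * norm h"
      by (simp add: fun_cong[OF J_eq] sum_distrib_right)
  qed
  have "continuous_on K (\<lambda>x. \<Sum>i\<in>UNIV. norm (g i x))"
    by (intro continuous_intros continuous_on_subset[OF g(2)]) auto
  then have "bdd_above ((\<lambda>x. \<Sum>i\<in>UNIV. norm (g i x)) ` K)"
    using assms(2) by (intro bounded_imp_bdd_above compact_imp_bounded compact_continuous_image)
  then obtain B where "\<And>x. x \<in> K \<Longrightarrow> (\<Sum>i\<in>UNIV. norm (g i x)) \<le> B"
    by (auto simp: bdd_above_def)
  then show "bdd_above ((\<lambda>x. onorm (\<lambda>h. jacobian f (at x) *v h)) ` K)"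
    by (intro bdd_aboveI2) (rule order_trans[OF bound])
qed


subsection \<open>Regularity of blocks\<close>

lemma C1_vec_add:
  assumes "C1_vec n f" "C1_vec n g"
  shows "C1_vec n (\<lambda>x. f x + g x)"
  using assms unfolding C1_vec_def by (auto intro: C1_add)

lemma C1_vec_hadamard:
  assumes "C1_vec n f" "C1_vec n g"
  shows "C1_vec n (\<lambda>x. hadamard (f x) (g x))"
  using assms unfolding C1_vec_def hadamard_def by (auto intro: C1_mult)

lemma C1_vec_smult:
  assumes "C1 a" "C1_vec n f"
  shows "C1_vec n (\<lambda>x. a x \<cdot>\<^sub>v f x)"
  using assms unfolding C1_vec_def by (auto intro: C1_mult)

lemma C1_vec_append:
  assumes "C1_vec m f" "C1_vec n g"
  shows "C1_vec (m + n) (\<lambda>x. f x @\<^sub>v g x)"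
proof (rule C1_vecI)
  fix i assume "i < m + n"
  then show "C1 (\<lambda>x. (f x @\<^sub>v g x) $v i)"
    using assms by (cases "i < m") (auto simp: C1_vec_dim intro: C1_vec_index)
qed (use assms in \<open>simp add: C1_vec_dim\<close>)

text \<open>The matrix may vary with \<open>x\<close>, which covers trainable weights and fixed
  rotations alike.\<close>

lemma C1_vec_mult_mat_vec:
  assumes "\<And>x. A x \<in> carrier_mat m n" "\<And>i j. i < m \<Longrightarrow> j < n \<Longrightarrow> C1 (\<lambda>x. A x $$ (i, j))"
    and "C1_vec n f"
  shows "C1_vec m (\<lambda>x. A x *\<^sub>v f x)"
proof (rule C1_vecI)
  have A: "dim_row (A x) = m" "dim_col (A x) = n" for x
    using assms(1)[of x] by auto
  show "dim_vec (A x *\<^sub>v f x) = m" for x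
    by (simp add: A)
  fix i assume i: "i < m"
  have "(A x *\<^sub>v f x) $v i = (\<Sum>j\<in>{0..<n}. A x $$ (i, j) * f x $v j)" for x
    using i by (simp add: A scalar_prod_def C1_vec_dim[OF assms(3)])
  then show "C1 (\<lambda>x. (A x *\<^sub>v f x) $v i)"
    using i by (auto intro!: C1_sum C1_mult assms(2) C1_vec_index[OF assms(3)])
qed

lemma C1_vec_softmax:
  assumes "C1_vec n f"
  shows "C1_vec n (\<lambda>x. softmax (f x))"
proof (rule C1_vecI)
  fix i assume i: "i < n"
  \<comment> \<open>The index \<open>i\<close> shows that the sum of positive terms is not
    empty.\<close>
  then have "(\<Sum>j<n. exp (f x $v j)) \<noteq> 0" for x
    by (intro less_imp_neq[symmetric] sum_pos) auto
  then show "C1 (\<lambda>x. softmax (f x) $v i)"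
    using i by (auto simp: softmax_def C1_vec_dim[OF assms]
        intro!: C1_divide C1_sum C1_exp C1_vec_index[OF assms])
qed (simp add: softmax_def C1_vec_dim[OF assms])

lemma C1_silu:
  assumes "C1 f"
  shows "C1 (\<lambda>x. silu (f x))"
proof -
  \<comment> \<open>Writing \<open>- 1 * t\<close> for \<open>- t\<close> makes the exponent a
    product, to which \<open>C1_mult\<close> and \<open>C1_const\<close> apply.\<close>
  have "1 + exp (- 1 * t) \<noteq> 0" for t :: real
    using exp_gt_zero[of "- 1 * t"] by linarith
  then have "C1 (\<lambda>x. f x / (1 + exp (- 1 * f x)))"
    by (intro C1_divide C1_add C1_exp C1_mult C1_const assms)
  then show ?thesis by (simp add: silu_def)
qed

lemma C1_vec_swiglu:
  assumes "C1_vec n f" "C1_vec n g"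
  shows "C1_vec n (\<lambda>x. swiglu (f x) (g x))"
  unfolding swiglu_def
  by (rule C1_vec_hadamard[OF _ assms(2)]) (use assms(1) in \<open>auto simp: C1_vec_def intro: C1_silu\<close>)

lemma C1_vec_rmsnorm:
  assumes "\<epsilon> > 0" "C1_vec n g" "C1_vec n f"
  shows "C1_vec n (\<lambda>x. rmsnorm \<epsilon> (g x) (f x))"
proof -
  \<comment> \<open>The first summand is nonnegative, also for \<open>n = 0\<close>, where
    \<open>1 / real n\<close> is 0; \<open>\<epsilon>\<close> makes the total positive.\<close>
  have pos: "1 / real n * (\<Sum>j<n. (f x $v j)\<^sup>2) + \<epsilon> > 0" for x
    using assms(1) by (intro add_nonneg_pos mult_nonneg_nonneg sum_nonneg) auto
  have "C1 (\<lambda>x. 1 / sqrt (1 / real n * (\<Sum>j<n. (f x $v j)\<^sup>2) + \<epsilon>))"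
    unfolding power2_eq_square
    by (intro C1_divide C1_sqrt C1_add C1_mult C1_sum C1_const C1_vec_index[OF assms(3)])
       (use pos in \<open>auto simp: power2_eq_square less_imp_neq[symmetric]\<close>)
  then show ?thesis
    unfolding rmsnorm_def C1_vec_dim[OF assms(3)] by (intro C1_vec_smult C1_vec_hadamard assms)
qed

lemma C1_vec_param_vec: "C1_vec n (param_vec n c)"
  by (rule C1_vecI) (simp_all add: param_vec_def C1_component)

text \<open>Position \<open>k\<close> of the flattened product is row \<open>k div c\<close>, column
  \<open>k mod c\<close>. The point is that every entry read from the factors lies in the range
  controlled by \<open>C1_vec\<close>.\<close>

lemma C1_vec_flat_matmul:
  assumes f: "C1_vec (a * b) f" and g: "C1_vec (b * c) g"
  shows "C1_vec (a * c) (\<lambda>x. flat_matmul a b c (f x) (g x))"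
proof (rule C1_vecI)
  fix k assume k: "k < a * c"
  then have c: "c > 0" by (cases c) auto
  have f_index: "k div c * b + j < a * b" if "j < b" for j
  proof -
    have "k div c * b + j < Suc (k div c) * b" using that by simp
    \<comment> \<open>From \<open>k < a * c\<close> it follows that
      \<open>k div c < a\<close>.\<close>
    also have "\<dots> \<le> a * b"
      using k by (intro mult_le_mono1) (simp add: less_mult_imp_div_less Suc_leI)
    finally show ?thesis .
  qed
  have g_index: "j * c + k mod c < b * c" if "j < b" for j
  proof -
    have "j * c + k mod c < Suc j * c" using c by simp
    also have "\<dots> \<le> b * c" using that by (intro mult_le_mono1) simp
    finally show ?thesis .
  qed
  show "C1 (\<lambda>x. flat_matmul a b c (f x) (g x) $v k)"
    using k by (auto simp: flat_matmul_def intro!: C1_sum C1_mult C1_vec_index[OF f]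
        C1_vec_index[OF g] f_index g_index)
qed (simp add: flat_matmul_def)

text \<open>
  Substituting a curve \<open>\<theta> \<mapsto> V \<theta>\<close> for the input makes the claim stable under \<open>comp\<close> without joint
  differentiability in \<open>(\<theta>, u)\<close>.
\<close>

lemma C1_vec_built:
  assumes "built \<epsilon> n m F" "\<epsilon> > 0" "C1_vec n V"
  shows "C1_vec m (\<lambda>\<theta>. F \<theta> (V \<theta>))"
  using assms
proof (induction arbitrary: V rule: built.induct)
  case (linear n m w)
  then show ?case
    by (intro C1_vec_mult_mat_vec[where n = n]) (auto simp: param_mat_def C1_component)
next
  case (rope n Q)
  then show ?case
    by (intro C1_vec_mult_mat_vec[where n = n]) (auto simp: rotation_mat_def C1_const)
next
  case (softmax n)
  then show ?case by (intro C1_vec_softmax)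
next
  case (swiglu n m f g)
  then show ?case by (intro C1_vec_swiglu)
next
  case (rmsnorm n c)
  then show ?case by (intro C1_vec_rmsnorm C1_vec_param_vec)
next
  case (comp n m f k g)
  then show ?case by blast
next
  case (sum n m f g)
  then show ?case by (intro C1_vec_add)
next
  case (prod n m f g)
  then show ?case by (intro C1_vec_hadamard)
next
  case (matmul n a b f c g)
  then show ?case by (intro C1_vec_flat_matmul)
next
  case (select m s n)
  then show ?case by (intro C1_vecI) (auto intro: C1_vec_index)
next
  case (concat n m f k g)
  then show ?case by (intro C1_vec_append)
qed

section \<open>Blocks and residual maps as functions of the parameters\<close>

lemma C1_vec_to_dvec:
  fixes f :: "'a :: real_inner \<Rightarrow> real ^ 'd"
  shows "C1_cart f \<Longrightarrow> C1_vec CARD('d) (\<lambda>x. to_dvec (f x))"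
  by (rule C1_vecI) (simp_all add: to_dvec_def C1_cart_def)

lemma C1_cart_of_dvec:
  assumes "C1_vec CARD('d) f"
  shows "C1_cart (\<lambda>x. of_dvec (f x) :: real ^ 'd)"
proof -
  \<comment> \<open>On a finite set the enumeration is a bijection onto the numbers below its
    cardinality, so no index is out of range.\<close>
  have "to_nat_on UNIV i < CARD('d)" for i :: 'd
    using to_nat_on_finite[of "UNIV :: 'd set"] by (auto simp: bij_betw_def)
  then show ?thesis
    using assms by (simp add: C1_cart_def of_dvec_def C1_vec_index)
qed

text \<open>The curve \<open>V\<close> again replaces the input, so that compositions of blocks, and
  later successive layers, can be chained.\<close>

lemma C1_cart_block:
  fixes G :: "real ^ 'p \<Rightarrow> real ^ 'd \<Rightarrow> real ^ 'd"
  assumes "block \<epsilon> G" "\<epsilon> > 0" "C1_cart V"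
  shows "C1_cart (\<lambda>\<theta>. G \<theta> (V \<theta>))"
  using assms
proof (induction arbitrary: V rule: block.induct)
  case (residual F c)
  have "C1_vec CARD('d) (\<lambda>\<theta>. rmsnorm \<epsilon> (param_vec CARD('d) c \<theta>) (to_dvec (V \<theta>)))"
    by (intro C1_vec_rmsnorm C1_vec_param_vec C1_vec_to_dvec residual.prems)
  from C1_vec_built[OF residual.hyps residual.prems(1) this]
  have "C1_vec CARD('d)
      (\<lambda>\<theta>. F \<theta> (rmsnorm \<epsilon> (param_vec CARD('d) c \<theta>) (to_dvec (V \<theta>))))" .
  note C1_cart_of_dvec[OF this]
  with residual.prems(2) show ?case
    by (simp add: C1_cart_def C1_add)
next
  case (comp G H)
  then show ?case by blast
qed

text \<open>Induction over the layers: the hidden state after \<open>l\<close> layers, as a function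
  of the parameters, is the curve fed into block \<open>Suc l\<close>.\<close>

lemma C1_cart_residual_map:
  assumes "\<And>k. k \<in> {1..l} \<Longrightarrow> block \<epsilon> (G k)" "\<epsilon> > 0"
  shows "C1_cart (\<lambda>\<theta>. residual_map G l \<theta> x)"
  using assms(1)
proof (induction l)
  case 0
  show ?case by (simp add: C1_cart_def C1_const)
next
  case (Suc l)
  have "C1_cart (\<lambda>\<theta>. residual_map G l \<theta> x)"
    by (rule Suc.IH) (simp add: Suc.prems)
  from C1_cart_block[OF Suc.prems assms(2) this, of "Suc l"] show ?case by simp
qed


subsection \<open>The step estimate\<close>

text \<open>Any point of \<open>K\<close> gives a nonnegative norm below the supremum; over the
  empty set the supremum would carry no such information.\<close>

lemma sup_jacobian_norm_nonneg:
  fixes f :: "real ^ 'p \<Rightarrow> real ^ 'd"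
  assumes "C1_cart f" "compact K" "K \<noteq> {}"
  shows "0 \<le> sup_jacobian_norm f K"
proof -
  obtain x where "x \<in> K" using assms(3) by blast
  have "0 \<le> onorm (\<lambda>h. jacobian f (at x) *v h)"
    by (intro onorm_pos_le) simp
  also have "\<dots> \<le> sup_jacobian_norm f K"
    unfolding sup_jacobian_norm_def by (rule cSUP_upper[OF \<open>x \<in> K\<close> C1_cart_jacobian(2)[OF assms(1,2)]])
  finally show ?thesis .
qed

text \<open>The mean value inequality is applied on the segment, which is convex as \<open>K\<close>
  need not be; passing to the supremum over \<open>K\<close> only enlarges the constant.\<close>

lemma norm_diff_le_sup_jacobian_norm:
  fixes f :: "real ^ 'p \<Rightarrow> real ^ 'd"
  assumes "C1_cart f" "compact K" "closed_segment x y \<subseteq> K"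
  shows "norm (f y - f x) \<le> sup_jacobian_norm f K * norm (y - x)"
proof (rule differentiable_bound[where f' = "\<lambda>z h. jacobian f (at z) *v h"])
  show "(f has_derivative (\<lambda>h. jacobian f (at z) *v h)) (at z within closed_segment x y)" for z
    by (rule has_derivative_at_withinI[OF C1_cart_jacobian(1)[OF assms(1,2)]])
  show "onorm (\<lambda>h. jacobian f (at z) *v h) \<le> sup_jacobian_norm f K" if "z \<in> closed_segment x y" for z
    unfolding sup_jacobian_norm_def
    using that assms(3) by (intro cSUP_upper C1_cart_jacobian(2)[OF assms(1,2)]) auto
qed auto

text \<open>The mask acts on each coordinate separately, by a factor 0 or 1.\<close>

lemma norm_diag_matrix_mult_le:
  assumes "\<And>i. m $ i \<in> {0, 1}"
  shows "norm (diag_matrix m *v v) \<le> norm v"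
proof (rule norm_le_componentwise_cart)
  fix i
  have "(diag_matrix m *v v) $ i = m $ i * v $ i"
    by (simp add: diag_matrix_def matrix_vector_mult_def if_distrib[where f = "\<lambda>a. a * _"] cong: if_cong)
  then show "norm ((diag_matrix m *v v) $ i) \<le> norm (v $ i)"
    using assms[of i] by auto
qed

theorem mainTheorem1:
  fixes \<Theta> K :: "(real ^ 'p) set"
    and G :: "nat \<Rightarrow> real ^ 'p \<Rightarrow> real ^ 'd \<Rightarrow> real ^ 'd"
    and N :: nat
    and \<epsilon> \<eta> :: real
    and \<L> :: "real ^ 'p \<Rightarrow> real"
    and \<theta> \<theta>' m :: "real ^ 'p"
    and M :: "real ^ 'p ^ 'p"
  assumes "open \<Theta>"
    and "\<epsilon> > 0"
    and "\<And>l. l \<in> {1..N} \<Longrightarrow> block \<epsilon> (G l)"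
    and "\<theta> \<in> \<Theta>"
    and "\<L> differentiable (at \<theta>)"
    and "\<eta> > 0"
    and "\<And>i. m $ i \<in> {0, 1}"
    and "M = diag_matrix m"
    and "\<theta>' = \<theta> - \<eta> *\<^sub>R (M *v gradient \<L> \<theta>)"
    and "compact K"
    and "K \<subseteq> \<Theta>"
    and "{\<theta> + t *\<^sub>R (\<theta>' - \<theta>) | t. t \<in> {0..1}} \<subseteq> K"
  shows "\<forall>l\<le>N. \<forall>x :: real ^ 'd.
    norm (residual_map G l \<theta>' x - residual_map G l \<theta> x)
      \<le> \<eta> * sup_jacobian_norm (\<lambda>\<tau>. residual_map G l \<tau> x) K * norm (M *v gradient \<L> \<theta>) \<and>
    \<eta> * sup_jacobian_norm (\<lambda>\<tau>. residual_map G l \<tau> x) K * norm (M *v gradient \<L> \<theta>)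
      \<le> \<eta> * sup_jacobian_norm (\<lambda>\<tau>. residual_map G l \<tau> x) K * norm (gradient \<L> \<theta>)"
proof (intro allI impI)
  fix l and x :: "real ^ 'd"
  assume "l \<le> N"
  let ?R = "\<lambda>\<tau>. residual_map G l \<tau> x"
  have R: "C1_cart ?R"
    using assms(2,3) \<open>l \<le> N\<close> by (intro C1_cart_residual_map) auto
  have "closed_segment \<theta> \<theta>' = {\<theta> + t *\<^sub>R (\<theta>' - \<theta>) | t. t \<in> {0..1}}"
    by (auto simp: closed_segment_def algebra_simps)
  then have seg: "closed_segment \<theta> \<theta>' \<subseteq> K"
    using assms(12) by simp
  have "norm (?R \<theta>' - ?R \<theta>) \<le> sup_jacobian_norm ?R K * norm (\<theta>' - \<theta>)"
    by (rule norm_diff_le_sup_jacobian_norm[OF R assms(10) seg])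
  moreover have "norm (\<theta>' - \<theta>) = \<eta> * norm (M *v gradient \<L> \<theta>)"
    using assms(6,9) by simp
  ultimately have "norm (?R \<theta>' - ?R \<theta>) \<le> \<eta> * sup_jacobian_norm ?R K * norm (M *v gradient \<L> \<theta>)"
    by (simp add: mult_ac)
  \<comment> \<open>The segment contains its endpoints, so \<open>K\<close> is not empty. The sign
    allows multiplying the mask estimate by the constant.\<close>
  moreover have "0 \<le> sup_jacobian_norm ?R K"
    using seg by (intro sup_jacobian_norm_nonneg[OF R assms(10)]) auto
  then have "\<eta> * sup_jacobian_norm ?R K * norm (M *v gradient \<L> \<theta>)
      \<le> \<eta> * sup_jacobian_norm ?R K * norm (gradient \<L> \<theta>)"
    using assms(6) norm_diag_matrix_mult_le[OF assms(7)] unfolding assms(8)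
    by (intro mult_left_mono) auto
  ultimately show "norm (?R \<theta>' - ?R \<theta>) \<le> \<eta> * sup_jacobian_norm ?R K * norm (M *v gradient \<L> \<theta>) \<and>
      \<eta> * sup_jacobian_norm ?R K * norm (M *v gradient \<L> \<theta>)
        \<le> \<eta> * sup_jacobian_norm ?R K * norm (gradient \<L> \<theta>)"
    by blast
qed

end
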